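(* Let $h\ge 3$, let $m_1,\dots,m_h,n_1,\dots,n_h$ be positive integers, and let $G=\mathrm{NSG}(m_1,\ldots,m_h;n_1,\ldots,n_h)$, of order $n$, with eigenvalues $\lambda_1\ge\cdots\ge\lambda_n$. Suppose that for some $s$ with $2\le s\le h-1$ all vertices in $U_s$ are neutral vertices for the eigenvalue $\lambda_i\neq 0,-1$. Let $G'=\mathrm{NSG}(m_{s+1},\ldots,m_h;n_{s+1},\ldots,n_h)$, let $n'=|V(G')|=\sum_{j=s+1}^h(m_j+n_j)$, and let $\lambda'_1\ge\cdots\ge\lambda'_{n'}$ be the eigenvalues of $G'$. Then $\lambda_i=\lambda'_j$ for some $j\in\{1,\ldots,n'\}$. Moreover, $j<i<n-n'+j$, and if $i\le n'$ then $\lambda_i\neq\lambda'_{n'}$.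
   Context: All graphs are simple; eigenvalues of a graph are those of its adjacency matrix, listed in non-increasing order with multiplicity. The nested split (threshold) graph $\mathrm{NSG}(m_1,\ldots,m_h;n_1,\ldots,n_h)$ has vertex set the disjoint union of sets $U_1,\dots,U_h,V_1,\dots,V_h$ with $|U_i|=m_i$, $|V_i|=n_i$; the set $V=\bigcup_i V_i$ induces a clique, the set $U=\bigcup_i U_i$ induces a co-clique, and a vertex $u\in U_i$ is adjacent to a vertex $v\in V_j$ if and only if $j\le i$. For an eigenvalue $\lambda$ of a graph $G$ of multiplicity $k\ge1$ and a vertex $v$, $v$ is a downer, neutral, or Parter vertex for $\lambda$ according as the multiplicity of $\lambda$ as an eigenvalue of $G-v$ is $k-1$, $k$, or $k+1$. *)

theory Defs
  imports
    "Jordan_Normal_Form.Char_Poly"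
    "Graph_Theory.Digraph"
    "Graph_Theory.Bidirected_Digraph"
    "Graph_Theory.Pair_Digraph"
begin

text \<open>Simple graphs are the digraphs satisfying \<^locale>\<open>graph\<close>: finite, symmetric, without loops and
  parallel arcs. The definitions below are only meaningful for these.\<close>

definition adjacency_matrix :: "('a, 'b) pre_digraph \<Rightarrow> 'a list \<Rightarrow> real mat" where
  "adjacency_matrix G xs =
     mat (length xs) (length xs) (\<lambda>(i, j). if (xs ! i, xs ! j) \<in> arcs_ends G then 1 else 0)"

text \<open>The choice of the enumeration \<^term>\<open>xs\<close> of the vertices is irrelevant, see
  \<open>graph_char_poly_eq\<close> below.\<close>

definition graph_char_poly :: "('a, 'b) pre_digraph \<Rightarrow> real poly" where
  "graph_char_poly G =
     char_poly (adjacency_matrix G (SOME xs. distinct xs \<and> set xs = verts G))"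

text \<open>Adjacency matrices of graphs are real symmetric, so all their complex eigenvalues are real,
  and algebraic and geometric multiplicities agree.\<close>

definition eigenvalue_multiplicity :: "('a, 'b) pre_digraph \<Rightarrow> real \<Rightarrow> nat" where
  "eigenvalue_multiplicity G x = Polynomial.order x (graph_char_poly G)"

definition graph_eigenvalues :: "('a, 'b) pre_digraph \<Rightarrow> real list" where
  "graph_eigenvalues G = rev (sorted_list_of_multiset (proots (graph_char_poly G)))"

text \<open>The \<^term>\<open>i\<close>-th largest eigenvalue; indices run over \<^term>\<open>{1..card (verts G)}\<close>.\<close>

definition nth_eigenvalue :: "('a, 'b) pre_digraph \<Rightarrow> nat \<Rightarrow> real" where
  "nth_eigenvalue G i = graph_eigenvalues G ! (i - 1)"

definition neutral_vertex :: "('a, 'b) pre_digraph \<Rightarrow> real \<Rightarrow> 'a \<Rightarrow> bool" where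
  "neutral_vertex G x v \<longleftrightarrow>
     v \<in> verts G \<and> eigenvalue_multiplicity G x \<ge> 1 \<and>
     eigenvalue_multiplicity (pre_digraph.del_vert G v) x = eigenvalue_multiplicity G x"

text \<open>\<open>NU i k\<close> and \<open>NV i k\<close> are the \<open>k\<close>-th vertices (counted from \<open>0\<close>) of the cells
  \<open>U\<^sub>i\<close> and \<open>V\<^sub>i\<close>; cells are numbered from \<open>1\<close>.\<close>

datatype nsg_vertex = NU nat nat | NV nat nat

definition nsg_U :: "(nat \<Rightarrow> nat) \<Rightarrow> nat \<Rightarrow> nsg_vertex set" where
  "nsg_U m i = NU i ` {..<m i}"

definition nsg_V :: "(nat \<Rightarrow> nat) \<Rightarrow> nat \<Rightarrow> nsg_vertex set" where
  "nsg_V n i = NV i ` {..<n i}"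

fun nsg_adj :: "nsg_vertex \<Rightarrow> nsg_vertex \<Rightarrow> bool" where
  "nsg_adj (NU i k) (NU j l) \<longleftrightarrow> False"
| "nsg_adj (NV i k) (NV j l) \<longleftrightarrow> (i, k) \<noteq> (j, l)"
| "nsg_adj (NU i k) (NV j l) \<longleftrightarrow> j \<le> i"
| "nsg_adj (NV j l) (NU i k) \<longleftrightarrow> j \<le> i"

text \<open>\<open>nsg h m n\<close> is \<open>NSG(m 1, \<dots>, m h; n 1, \<dots>, n h)\<close>.\<close>

definition nsg_verts :: "nat \<Rightarrow> (nat \<Rightarrow> nat) \<Rightarrow> (nat \<Rightarrow> nat) \<Rightarrow> nsg_vertex set" where
  "nsg_verts h m n = (\<Union>i\<in>{1..h}. nsg_U m i) \<union> (\<Union>i\<in>{1..h}. nsg_V n i)"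

definition nsg ::
    "nat \<Rightarrow> (nat \<Rightarrow> nat) \<Rightarrow> (nat \<Rightarrow> nat) \<Rightarrow> (nsg_vertex, nsg_vertex \<times> nsg_vertex) pre_digraph" where
  "nsg h m n = with_proj
     \<lparr> pverts = nsg_verts h m n,
       parcs = {(x, y). x \<in> nsg_verts h m n \<and> y \<in> nsg_verts h m n \<and> nsg_adj x y} \<rparr>"

lemma finite_nsg_verts: "finite (nsg_verts h m n)"
  by (auto simp: nsg_verts_def nsg_U_def nsg_V_def)

lemma nsg_adj_sym: "nsg_adj x y \<Longrightarrow> nsg_adj y x"
  by (cases x; cases y) auto

lemma nsg_adj_irrefl: "\<not> nsg_adj x x"
  by (cases x) auto

lemma graph_nsg: "graph (nsg h m n)"
proof -
  let ?G = "\<lparr> pverts = nsg_verts h m n,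
       parcs = {(x, y). x \<in> nsg_verts h m n \<and> y \<in> nsg_verts h m n \<and> nsg_adj x y} \<rparr>"
  have "finite (parcs ?G)"
    by (rule finite_subset[of _ "nsg_verts h m n \<times> nsg_verts h m n"])
      (auto simp: finite_nsg_verts)
  then have "pair_graph ?G"
    by unfold_locales
      (auto simp: finite_nsg_verts nsg_adj_irrefl symmetric_def sym_def intro: nsg_adj_sym)
  then show ?thesis
    unfolding nsg_def by (rule pair_graph.pair_graphD_graph)
qed

lemma card_verts_nsg: "card (verts (nsg h m n)) = (\<Sum>i=1..h. m i + n i)"
proof -
  have "card (\<Union>i\<in>{1..h}. nsg_U m i) = (\<Sum>i=1..h. m i)"
    by (subst card_UN_disjoint) (auto simp: nsg_U_def card_image inj_on_def)
  moreover have "card (\<Union>i\<in>{1..h}. nsg_V n i) = (\<Sum>i=1..h. n i)"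
    by (subst card_UN_disjoint) (auto simp: nsg_V_def card_image inj_on_def)
  ultimately show ?thesis
    unfolding nsg_def nsg_verts_def with_proj_simps pair_pre_digraph.simps
    by (subst card_Un_disjoint) (auto simp: nsg_U_def nsg_V_def sum.distrib)
qed

lemma char_poly_adjacency_matrix_perm:
  assumes "distinct xs" "distinct ys" "set xs = set ys"
  shows "char_poly (adjacency_matrix G xs) = char_poly (adjacency_matrix G ys)"
proof -
  have "mset ys = mset xs"
    using assms by (metis set_eq_iff_mset_eq_distinct)
  then obtain p where p: "p permutes {..<length xs}" and ys: "permute_list p xs = ys"
    by (rule mset_eq_permutation)
  define n where "n = length xs"
  have p: "p permutes {0..<n}"
    using p by (simp add: n_def atLeast0LessThan)
  have pn: "p i < n \<longleftrightarrow> i < n" for i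
    using permutes_in_image[OF p, of i] by simp
  have pinj: "p i = p j \<longleftrightarrow> i = j" for i j
    using permutes_inj[OF p] by (auto simp: inj_on_def)
  have nth: "ys ! i = xs ! p i" if "i < n" for i
    using that ys p by (auto simp: n_def permute_list_def)
  have len: "length ys = n"
    using ys by (auto simp: n_def)
  define A where "A = char_poly_matrix (adjacency_matrix G xs)"
  define B where "B = mat n n (\<lambda>(i, j). A $$ (p i, j))"
  have A: "A \<in> carrier_mat n n"
    unfolding A_def by (rule char_poly_matrix_closed) (simp add: adjacency_matrix_def n_def)
  have B: "B \<in> carrier_mat n n"
    by (simp add: B_def)
  define C where "C = mat n n (\<lambda>(i, j). transpose_mat B $$ (p i, j))"
  have C: "C \<in> carrier_mat n n"
    by (simp add: C_def)
  have detB: "det B = signof p * det A"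
    unfolding B_def by (rule det_permute_rows[OF A p])
  have "det C = signof p * det (transpose_mat B)"
    unfolding C_def by (rule det_permute_rows) (use B p in auto)
  then have "det C = signof p * signof p * det A"
    using det_transpose[OF B] detB by (simp add: mult.assoc)
  also have "\<dots> = det A"
    by (simp add: sign_def)
  finally have "det (transpose_mat C) = det A"
    using det_transpose[OF C] by simp
  moreover have "transpose_mat C = char_poly_matrix (adjacency_matrix G ys)"
    by (rule eq_matI)
      (auto simp: C_def B_def A_def char_poly_matrix_def adjacency_matrix_def len nth pn pinj
        n_def[symmetric])
  ultimately show ?thesis
    by (simp add: char_poly_def A_def)
qed

lemma graph_char_poly_eq:
  assumes "distinct xs" "set xs = verts G"
  shows "graph_char_poly G = char_poly (adjacency_matrix G xs)"
proof -
  let ?ys = "SOME ys. distinct ys \<and> set ys = verts G"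
  have "distinct ?ys \<and> set ?ys = verts G"
    by (rule someI[of _ xs]) (use assms in auto)
  then show ?thesis
    unfolding graph_char_poly_def using assms by (intro char_poly_adjacency_matrix_perm) auto
qed

end

theory Submission
  imports Defs
begin

text \<open>Let \<open>\<lambda> \<noteq> 0, -1\<close> be an eigenvalue of \<open>G\<close>. An eigenvector vanishing at a vertex of \<open>U\<^sub>h\<close> is zero, as one sees by
  descending through the cells; so \<open>\<lambda>\<close> is simple, in \<open>G\<close> and in \<open>G'\<close>. Neutrality of \<open>u \<in> U\<^sub>s\<close> gives an
  eigenvector \<open>z\<close> of \<open>G\<close> with \<open>z u = 0\<close>. The equation at \<open>u\<close> says that \<open>z\<close> sums to zero over
  \<open>V\<^sub>1, \<dots>, V\<^sub>s\<close>, which is exactly what is needed for the restriction of \<open>z\<close> to \<open>G'\<close> to be an eigenvector.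
  Cauchy interlacing then yields the weak inequalities. Equality in one of them would produce an eigenvector
  of \<open>G\<close> supported on \<open>G'\<close>, and comparing the equations at \<open>V\<^sub>s\<close> and at the later cells shows that no such
  eigenvector exists.\<close>

section \<open>The spectral theorem for real symmetric matrices\<close>

lemma nonzero_vec_entry:
  assumes "v \<in> carrier_vec n" "v \<noteq> 0\<^sub>v n"
  obtains i where "i < n" "v $ i \<noteq> 0"
proof -
  have "\<exists>i<n. v $ i \<noteq> 0"
  proof (rule ccontr)
    assume "\<not> (\<exists>i<n. v $ i \<noteq> 0)"
    then have "v = 0\<^sub>v n"
      using assms(1) by (intro eq_vecI) auto
    then show False
      using assms(2) by contradiction
  qed
  then show ?thesis
    using that by blast
qed

text \<open>The fundamental theorem of algebra gives a complex eigenvalue \<open>z\<close> with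
  eigenvector \<open>w\<close>. The form \<open>q\<close> = w* A w equals \<open>z\<close> times the
  positive number \<open>s\<close>, and conjugating and swapping indices fixes \<open>q\<close>
  because \<open>A\<close> is real and symmetric. Hence \<open>z\<close> is real, and it is a root
  of the real characteristic polynomial.\<close>

lemma symmetric_real_mat_eigenvalue_exists:
  fixes A :: "real mat"
  assumes A: "A \<in> carrier_mat n n" and sym: "transpose_mat A = A" and n: "n > 0"
  shows "\<exists>\<mu>. eigenvalue A \<mu>"
proof -
  define C where "C = map_mat complex_of_real A"
  have C: "C \<in> carrier_mat n n"
    using A by (simp add: C_def)
  have "degree (char_poly C) = n"
    using degree_monic_char_poly[OF C] by simp
  then have "\<not> constant (poly (char_poly C))"
    using n by (simp add: constant_degree)
  then obtain z where z: "poly (char_poly C) z = 0"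
    using fundamental_theorem_of_algebra by blast
  then have "eigenvalue C z"
    using eigenvalue_root_char_poly[OF C] by simp
  then obtain w where w: "w \<in> carrier_vec n" "w \<noteq> 0\<^sub>v n" "C *\<^sub>v w = z \<cdot>\<^sub>v w"
    unfolding eigenvalue_def eigenvector_def using C by auto
  have Aij: "A $$ (i, j) = A $$ (j, i)" if "i < n" "j < n" for i j
    using that A arg_cong[OF sym, of "\<lambda>M. M $$ (i, j)"] by simp
  have row: "(\<Sum>j<n. complex_of_real (A $$ (i, j)) * w $ j) = z * w $ i" if "i < n" for i
    using that A w(1) arg_cong[OF w(3), of "\<lambda>v. v $ i"]
    by (simp add: C_def scalar_prod_def lessThan_atLeast0)
  define q where "q = (\<Sum>i<n. \<Sum>j<n. complex_of_real (A $$ (i, j)) * w $ j * cnj (w $ i))"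
  define s where "s = (\<Sum>i<n. (cmod (w $ i))\<^sup>2)"
  have "q = (\<Sum>i<n. z * w $ i * cnj (w $ i))"
    unfolding q_def by (intro sum.cong refl) (simp add: row[symmetric] sum_distrib_right)
  also have "\<dots> = z * complex_of_real s"
    by (simp add: s_def sum_distrib_left mult.assoc complex_norm_square[symmetric] del: of_real_power)
  finally have qz: "q = z * complex_of_real s" .
  have "cnj q = (\<Sum>i<n. \<Sum>j<n. complex_of_real (A $$ (i, j)) * cnj (w $ j) * w $ i)"
    by (simp add: q_def)
  also have "\<dots> = (\<Sum>j<n. \<Sum>i<n. complex_of_real (A $$ (i, j)) * cnj (w $ j) * w $ i)"
    by (rule sum.swap)
  also have "\<dots> = q"
    unfolding q_def by (intro sum.cong refl) (simp add: Aij)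
  finally have "cnj q = q" .
  obtain i where "i < n" "w $ i \<noteq> 0"
    using nonzero_vec_entry[OF w(1,2)] by blast
  then have "s > 0"
    unfolding s_def by (intro sum_pos2[of _ i]) auto
  then have "cnj z = z"
    using \<open>cnj q = q\<close> qz by simp
  then have zr: "z = complex_of_real (Re z)"
    by (simp add: complex_eq_iff)
  have "char_poly C = map_poly complex_of_real (char_poly A)"
    unfolding C_def by (rule of_real_hom.char_poly_hom[OF A])
  then have "poly (char_poly A) (Re z) = 0"
    using z zr by (metis of_real_hom.poly_map_poly of_real_eq_0_iff)
  then show ?thesis
    using eigenvalue_root_char_poly[OF A] by blast
qed

text \<open>\<open>H\<close> is the reflection I - 2 w w^T / (w^T w) with w = v - e_0, which
  exchanges e_0 and \<open>v\<close>. It completes a unit vector to an orthogonal matrix without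
  Gram-Schmidt, and that matrix is its own transpose and inverse.\<close>

lemma householder_reflection:
  fixes v :: "real vec"
  assumes v: "v \<in> carrier_vec n" and n: "n > 0" and norm: "(\<Sum>i<n. v $ i * v $ i) = 1"
  shows "\<exists>H\<in>carrier_mat n n. transpose_mat H = H \<and> H * H = 1\<^sub>m n \<and> H *\<^sub>v unit_vec n 0 = v"
proof (cases "v = unit_vec n 0")
  \<comment> \<open>Here w = 0 and there is no reflection; the identity serves instead.\<close>
  case True
  then show ?thesis
    by (intro bexI[of _ "1\<^sub>m n"]) auto
next
  case False
  define w where "w i = v $ i - (if i = 0 then 1 else 0)" for i
  define c where "c = (\<Sum>i<n. w i * w i)"
  define H where "H = mat n n (\<lambda>(i, j). (if i = j then 1 else 0) - 2 / c * w i * w j)"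
  have H: "H \<in> carrier_mat n n"
    by (simp add: H_def)
  \<comment> \<open>As \<open>v\<close> has norm 1, |v - e_0|^2 = 2 - 2 v_0 = -2 w_0. This is the
    identity that makes \<open>H\<close> send e_0 to \<open>v\<close>.\<close>
  have "c = (\<Sum>i<n. v $ i * v $ i - (if i = 0 then 2 * v $ 0 - 1 else 0))"
    unfolding c_def w_def by (intro sum.cong refl) (auto simp: algebra_simps)
  also have "\<dots> = 2 - 2 * v $ 0"
    using n by (simp add: sum_subtractf norm)
  finally have c: "c = - 2 * w 0"
    by (simp add: w_def)
  obtain i where "i < n" "w i \<noteq> 0"
    using False v by (auto simp: w_def vec_eq_iff unit_vec_def)
  then have c0: "c > 0"
    unfolding c_def by (intro sum_pos2[of _ i]) (auto simp: zero_less_mult_iff)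
  have "H * H = 1\<^sub>m n"
  proof (rule eq_matI)
    fix i j assume "i < dim_row (1\<^sub>m n :: real mat)" "j < dim_col (1\<^sub>m n :: real mat)"
    then have ij: "i < n" "j < n" by auto
    have "(H * H) $$ (i, j) = (\<Sum>k<n. H $$ (i, k) * H $$ (k, j))"
      using ij H by (simp add: scalar_prod_def lessThan_atLeast0)
    also have "\<dots> = (\<Sum>k<n. (if k = i then if i = j then 1 else 0 else 0)
        - (if k = i then 2 / c * w i * w j else 0) - (if k = j then 2 / c * w i * w j else 0)
        + (4 / c\<^sup>2 * w i * w j) * (w k * w k))"
      by (intro sum.cong refl) (use ij in \<open>auto simp: H_def algebra_simps power2_eq_square\<close>)
    also have "\<dots> = (if i = j then 1 else 0) - 2 / c * w i * w j - 2 / c * w i * w j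
        + (4 / c\<^sup>2 * w i * w j) * (\<Sum>k<n. w k * w k)"
      unfolding sum.distrib sum_subtractf sum_distrib_left[symmetric] using ij by simp
    also have "\<dots> = (if i = j then 1 else 0) - 4 / c * w i * w j + 4 / c\<^sup>2 * w i * w j * c"
      by (simp add: c_def[symmetric])
    also have "\<dots> = 1\<^sub>m n $$ (i, j)"
      using ij c0 by (simp add: power2_eq_square field_simps)
    finally show "(H * H) $$ (i, j) = 1\<^sub>m n $$ (i, j)" .
  qed (use H in auto)
  moreover have "transpose_mat H = H"
    by (rule eq_matI) (auto simp: H_def)
  moreover have "H *\<^sub>v unit_vec n 0 = v"
  proof (rule eq_vecI)
    fix i assume "i < dim_vec v"
    then have i: "i < n" using v by simp
    have "(H *\<^sub>v unit_vec n 0) $ i = H $$ (i, 0)"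
      using i n H by simp
    also have "\<dots> = (if i = 0 then 1 else 0) - 2 / c * w 0 * w i"
      using i n by (simp add: H_def)
    also have "2 / c * w 0 = - 1"
      using c c0 by (simp add: field_simps)
    also have "(if i = 0 then 1 else 0) - (- 1) * w i = v $ i"
      by (simp add: w_def)
    finally show "(H *\<^sub>v unit_vec n 0) $ i = v $ i" .
  qed (use H v in auto)
  ultimately show ?thesis
    using H by blast
qed

text \<open>Conjugation by a Householder reflection turns a unit eigenvector into e_0. The first
  column then has only its diagonal entry, by symmetry so does the first row, and the induction
  hypothesis diagonalizes the remaining block. Similarity is by an orthogonal matrix
  throughout.\<close>

theorem symmetric_real_mat_diagonalizable:
  fixes A :: "real mat"
  assumes "A \<in> carrier_mat n n" and "transpose_mat A = A"
  shows "\<exists>P D. similar_mat_wit A D P (transpose_mat P) \<and> diagonal_mat D"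
  using assms
proof (induction n arbitrary: A)
  case 0
  then show ?case
    by (intro exI[of _ "1\<^sub>m 0"] exI[of _ A] conjI)
      (auto simp: diagonal_mat_def intro!: similar_mat_witI[of _ _ 0])
next
  case (Suc n)
  note A = Suc.prems(1)
  let ?N = "Suc n" and ?e = "unit_vec (Suc n) 0 :: real vec"
  obtain \<mu> where "eigenvalue A \<mu>"
    using symmetric_real_mat_eigenvalue_exists[OF Suc.prems] by blast
  then obtain u where u: "u \<in> carrier_vec ?N" "u \<noteq> 0\<^sub>v ?N" "A *\<^sub>v u = \<mu> \<cdot>\<^sub>v u"
    unfolding eigenvalue_def eigenvector_def using A by auto
  define c where "c = (\<Sum>i<?N. u $ i * u $ i)"
  obtain i where "i < ?N" "u $ i \<noteq> 0"
    using nonzero_vec_entry[OF u(1,2)] by blast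
  then have c0: "c > 0"
    unfolding c_def by (intro sum_pos2[of _ i]) (auto simp: zero_less_mult_iff)
  define v where "v = (1 / sqrt c) \<cdot>\<^sub>v u"
  have v: "v \<in> carrier_vec ?N"
    using u by (simp add: v_def)
  have Av: "A *\<^sub>v v = \<mu> \<cdot>\<^sub>v v"
    using u A by (simp add: v_def mult_mat_vec smult_smult_assoc mult.commute)
  have "(\<Sum>i<?N. v $ i * v $ i) = (\<Sum>i<?N. u $ i * u $ i / c)"
    using u c0 by (intro sum.cong refl) (auto simp: v_def field_simps)
  also have "\<dots> = 1"
    using c0 by (simp add: c_def sum_divide_distrib[symmetric] del: sum.lessThan_Suc)
  finally obtain H where H: "H \<in> carrier_mat ?N ?N" "transpose_mat H = H" "H * H = 1\<^sub>m ?N"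
      "H *\<^sub>v ?e = v"
    using householder_reflection[OF v] by blast
  define B where "B = H * A * H"
  have B: "B \<in> carrier_mat ?N ?N"
    using H A by (simp add: B_def)
  have AB: "similar_mat_wit A B H (transpose_mat H)"
  proof (rule similar_mat_witI[of _ _ ?N])
    have "H * B * H = (H * H) * A * (H * H)"
      using H(1) A by (simp add: B_def assoc_mult_mat[of _ ?N ?N _ ?N _ ?N])
    then show "A = H * B * transpose_mat H"
      using H A by simp
  qed (use H A B in auto)
  have Bsym: "transpose_mat B = B"
    using H(1,2) A Suc.prems(2)
    by (simp add: B_def transpose_mult[of _ ?N ?N _ ?N] assoc_mult_mat[of _ ?N ?N _ ?N _ ?N])
  have Hv: "H *\<^sub>v v = ?e"
    using H(1,3) by (simp add: H(4)[symmetric] assoc_mult_mat_vec[symmetric, of _ ?N ?N _ ?N])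
  have "B *\<^sub>v ?e = H *\<^sub>v (A *\<^sub>v v)"
    using H(1,4) A by (simp add: B_def assoc_mult_mat_vec[of _ ?N ?N _ ?N])
  also have "\<dots> = \<mu> \<cdot>\<^sub>v ?e"
    using H(1) v by (simp add: Av mult_mat_vec Hv)
  finally have Be: "B *\<^sub>v ?e = \<mu> \<cdot>\<^sub>v ?e" .
  have B_col: "B $$ (i, 0) = (if i = 0 then \<mu> else 0)" if "i < ?N" for i
    using that B arg_cong[OF Be, of "\<lambda>w. w $ i"] by (auto split: if_splits)
  have B_sym: "B $$ (i, j) = B $$ (j, i)" if "i < ?N" "j < ?N" for i j
    using that B arg_cong[OF Bsym, of "\<lambda>M. M $$ (i, j)"] by simp
  define B' where "B' = mat n n (\<lambda>(i, j). B $$ (Suc i, Suc j))"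
  have B': "B' \<in> carrier_mat n n"
    by (simp add: B'_def)
  have "transpose_mat B' = B'"
    by (rule eq_matI) (auto simp: B'_def B_sym)
  then obtain P' D' where PD': "similar_mat_wit B' D' P' (transpose_mat P')" "diagonal_mat D'"
    using Suc.IH[OF B'] by blast
  note P' = similar_mat_witD2[OF B' PD'(1)]
  define M where "M = mat 1 1 (\<lambda>_. \<mu>)"
  have M: "M \<in> carrier_mat 1 1"
    by (simp add: M_def)
  have block: "four_block_mat M (0\<^sub>m 1 n) (0\<^sub>m n 1) B' = B"
    by (rule eq_matI) (use B B_col B_sym B_col[OF _ ] in \<open>auto simp: M_def B'_def\<close>)
  define D where "D = four_block_mat M (0\<^sub>m 1 n) (0\<^sub>m n 1) D'"
  define Q where "Q = four_block_mat (1\<^sub>m 1) (0\<^sub>m 1 n) (0\<^sub>m n 1) P'"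
  have Q: "Q \<in> carrier_mat ?N ?N"
    using four_block_carrier_mat[OF one_carrier_mat[of 1] P'(6)] by (simp add: Q_def)
  have Qt: "transpose_mat Q = four_block_mat (1\<^sub>m 1) (0\<^sub>m 1 n) (0\<^sub>m n 1) (transpose_mat P')"
    unfolding Q_def using P'(6) by (subst transpose_four_block_mat[of _ 1 1 _ n _ n]) auto
  have "similar_mat_wit B D Q (transpose_mat Q)"
    unfolding block[symmetric] D_def Qt unfolding Q_def
    by (rule similar_mat_wit_four_block[OF similar_mat_wit_refl[OF M] PD'(1) _ _ M B'])
      (use P' in auto)
  from similar_mat_wit_trans[OF AB this]
  have "similar_mat_wit A D (H * Q) (transpose_mat (H * Q))"
    using H Q by (simp add: transpose_mult[of _ ?N ?N _ ?N])
  moreover have "diagonal_mat D"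
    using PD'(2) M P'(5) unfolding D_def diagonal_mat_def by auto
  ultimately show ?case
    by blast
qed

text \<open>Gaussian elimination: a nonzero entry in row \<open>i\<close> eliminates one unknown
  from the other equations, so equations and unknowns both decrease by one. A zero row is simply
  dropped.\<close>

lemma underdetermined_homogeneous_system:
  fixes M :: "'i \<Rightarrow> 'j \<Rightarrow> 'a::field"
  assumes "finite I" "finite J" "card I < card J"
  shows "\<exists>c. (\<exists>j\<in>J. c j \<noteq> 0) \<and> (\<forall>i\<in>I. (\<Sum>j\<in>J. M i j * c j) = 0)"
  using assms
proof (induction I arbitrary: J M rule: finite_induct)
  case empty
  then have "J \<noteq> {}" by auto
  then show ?case
    by (intro exI[of _ "\<lambda>_. 1"]) auto
next
  case (insert i I)
  show ?case
  proof (cases "\<forall>j\<in>J. M i j = 0")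
    case True
    have "card I < card J"
      using insert by simp
    from insert.IH[OF insert.prems(1) this] show ?thesis
      using True by auto
  next
    case False
    then obtain k where k: "k \<in> J" "M i k \<noteq> 0" by blast
    define J' where "J' = J - {k}"
    define M' where "M' i' j = M i' j - M i' k * M i j / M i k" for i' j
    have J': "finite J'" "k \<notin> J'" "J = insert k J'" "card I < card J'"
      using insert k by (auto simp: J'_def)
    from insert.IH[OF J'(1,4), of M'] obtain c where c: "\<exists>j\<in>J'. c j \<noteq> 0"
        "\<And>i'. i' \<in> I \<Longrightarrow> (\<Sum>j\<in>J'. M' i' j * c j) = 0"
      by blast
    \<comment> \<open>Back-substitution: the value at the pivot \<open>k\<close> is chosen to
      satisfy equation \<open>i\<close>.\<close>
    define d where "d = c(k := - (\<Sum>j\<in>J'. M i j * c j) / M i k)"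
    have sum_d: "(\<Sum>j\<in>J. M i' j * d j) =
        (\<Sum>j\<in>J'. M i' j * c j) - M i' k * (\<Sum>j\<in>J'. M i j * c j) / M i k" for i'
    proof -
      have "(\<Sum>j\<in>J'. M i' j * d j) = (\<Sum>j\<in>J'. M i' j * c j)"
        by (intro sum.cong) (use J' in \<open>auto simp: d_def\<close>)
      then show ?thesis
        using J' by (simp add: d_def)
    qed
    have "(\<Sum>j\<in>J. M i' j * d j) = 0" if "i' \<in> insert i I" for i'
    proof (cases "i' = i")
      case True
      then show ?thesis using k sum_d by simp
    next
      case False
      then have "(\<Sum>j\<in>J'. M' i' j * c j) = 0"
        using that c(2) by blast
      then show ?thesis
        unfolding sum_d M'_def
        by (simp add: left_diff_distrib sum_subtractf sum_distrib_left sum_divide_distrib mult.assoc)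
    qed
    moreover have "\<exists>j\<in>J. d j \<noteq> 0"
      using c(1) J' by (auto simp: d_def)
    ultimately show ?thesis by blast
  qed
qed

section \<open>Eigenbases and strict interlacing\<close>

definition eigenfunction :: "'a set \<Rightarrow> ('a \<Rightarrow> 'a \<Rightarrow> real) \<Rightarrow> real \<Rightarrow> ('a \<Rightarrow> real) \<Rightarrow> bool" where
  "eigenfunction V K t x \<longleftrightarrow> (\<forall>v\<in>V. (\<Sum>w\<in>V. K v w * x w) = t * x v)"

text \<open>An orthonormal basis of \<open>V \<rightarrow> \<real>\<close> consisting of eigenvectors \<open>\<phi> k\<close> of the symmetric kernel \<open>K\<close>,
  with eigenvalues \<open>e k\<close>. Values outside \<open>V\<close> are irrelevant.\<close>

locale eigenbasis =
  fixes V :: "'a set" and K :: "'a \<Rightarrow> 'a \<Rightarrow> real" and e :: "nat \<Rightarrow> real" and \<phi> :: "nat \<Rightarrow> 'a \<Rightarrow> real"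
  assumes finite_V: "finite V"
    and sym: "v \<in> V \<Longrightarrow> w \<in> V \<Longrightarrow> K v w = K w v"
    and eigen: "k < card V \<Longrightarrow> eigenfunction V K (e k) (\<phi> k)"
    and orthonormal: "k < card V \<Longrightarrow> l < card V \<Longrightarrow>
      (\<Sum>v\<in>V. \<phi> k v * \<phi> l v) = (if k = l then 1 else 0)"
    and complete: "v \<in> V \<Longrightarrow> w \<in> V \<Longrightarrow> (\<Sum>k<card V. \<phi> k v * \<phi> k w) = (if v = w then 1 else 0)"
begin

definition coef :: "('a \<Rightarrow> real) \<Rightarrow> nat \<Rightarrow> real" where
  "coef x k = (\<Sum>v\<in>V. x v * \<phi> k v)"

lemma eigen_eq: "k < card V \<Longrightarrow> v \<in> V \<Longrightarrow> (\<Sum>w\<in>V. K v w * \<phi> k w) = e k * \<phi> k v"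
  using eigen by (simp add: eigenfunction_def)

lemma expansion:
  assumes "v \<in> V"
  shows "x v = (\<Sum>k<card V. coef x k * \<phi> k v)"
proof -
  have "(\<Sum>k<card V. coef x k * \<phi> k v) = (\<Sum>k<card V. \<Sum>w\<in>V. x w * (\<phi> k w * \<phi> k v))"
    by (simp add: coef_def sum_distrib_right mult.assoc)
  also have "\<dots> = (\<Sum>w\<in>V. x w * (\<Sum>k<card V. \<phi> k w * \<phi> k v))"
    by (subst sum.swap) (simp add: sum_distrib_left)
  also have "\<dots> = (\<Sum>w\<in>V. if w = v then x v else 0)"
    by (intro sum.cong refl) (use assms in \<open>auto simp: complete\<close>)
  also have "\<dots> = x v"
    using assms finite_V by simp
  finally show ?thesis by simp
qed

lemma parseval: "(\<Sum>v\<in>V. x v * y v) = (\<Sum>k<card V. coef x k * coef y k)"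
proof -
  have "(\<Sum>v\<in>V. x v * y v) = (\<Sum>v\<in>V. \<Sum>k<card V. coef x k * (y v * \<phi> k v))"
    by (intro sum.cong refl, subst expansion[of _ x]) (auto simp: sum_distrib_left mult_ac)
  also have "\<dots> = (\<Sum>k<card V. coef x k * coef y k)"
    by (subst sum.swap) (simp add: coef_def sum_distrib_left)
  finally show ?thesis .
qed

text \<open>Symmetry of \<open>K\<close> lets the operator act on \<open>\<phi> k\<close> instead of
  \<open>x\<close>, so it is diagonal in these coordinates.\<close>

lemma coef_apply:
  assumes "k < card V"
  shows "coef (\<lambda>v. \<Sum>w\<in>V. K v w * x w) k = e k * coef x k"
proof -
  have "coef (\<lambda>v. \<Sum>w\<in>V. K v w * x w) k = (\<Sum>w\<in>V. \<Sum>v\<in>V. K v w * x w * \<phi> k v)"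
    unfolding coef_def sum_distrib_right by (rule sum.swap)
  also have "\<dots> = (\<Sum>w\<in>V. x w * (\<Sum>v\<in>V. K w v * \<phi> k v))"
    by (intro sum.cong refl) (auto simp: sum_distrib_left sym intro!: sum.cong)
  also have "\<dots> = e k * coef x k"
    using assms by (simp add: eigen_eq coef_def sum_distrib_left algebra_simps)
  finally show ?thesis .
qed

lemma quadratic_form:
  "(\<Sum>v\<in>V. x v * (\<Sum>w\<in>V. K v w * x w)) = (\<Sum>k<card V. e k * (coef x k * coef x k))"
  by (rule trans[OF parseval]) (auto simp: coef_apply intro!: sum.cong)

lemma exists_nonzero:
  assumes "k < card V"
  shows "\<exists>v\<in>V. \<phi> k v \<noteq> 0"
proof (rule ccontr)
  assume "\<not> (\<exists>v\<in>V. \<phi> k v \<noteq> 0)"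
  then have "(\<Sum>v\<in>V. \<phi> k v * \<phi> k v) = 0" by simp
  then show False using orthonormal[OF assms assms] by simp
qed

text \<open>The k-th coordinate satisfies \<open>e k * coef x k = t * coef x k\<close>; if
  \<open>t\<close> were not listed, all coordinates of \<open>x\<close> would vanish.\<close>

lemma eigenvalue_is_listed:
  assumes "eigenfunction V K t x" and "v \<in> V" "x v \<noteq> 0"
  shows "\<exists>k<card V. e k = t"
proof (rule ccontr)
  assume no: "\<not> ?thesis"
  have "coef x k = 0" if k: "k < card V" for k
  proof -
    have "e k * coef x k = coef (\<lambda>v. \<Sum>w\<in>V. K v w * x w) k"
      using coef_apply[OF k] by simp
    also have "\<dots> = t * coef x k"
      using assms(1) by (simp add: eigenfunction_def coef_def sum_distrib_left mult.assoc)
    finally show ?thesis using no k by auto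
  qed
  then show False
    using assms(2,3) expansion[of v x] by simp
qed

text \<open>Simplicity of \<open>t\<close>: two basis vectors for \<open>t\<close> have a
  combination vanishing at \<open>z\<close>, which is then zero on \<open>V\<close>. Orthonormality
  makes its coefficient \<open>\<phi> l z\<close> zero, so \<open>\<phi> l\<close> itself vanishes,
  a contradiction.\<close>

lemma eigenvalue_unique:
  assumes z: "z \<in> V"
    and determined: "\<And>x. eigenfunction V K t x \<Longrightarrow> x z = 0 \<Longrightarrow> \<forall>v\<in>V. x v = 0"
    and k: "k < card V" "e k = t" and l: "l < card V" "e l = t"
  shows "k = l"
proof (rule ccontr)
  assume "k \<noteq> l"
  define x where "x v = \<phi> l z * \<phi> k v - \<phi> k z * \<phi> l v" for v
  have "(\<Sum>w\<in>V. K v w * x w) = t * x v" if v: "v \<in> V" for v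
  proof -
    have "(\<Sum>w\<in>V. K v w * x w)
        = \<phi> l z * (\<Sum>w\<in>V. K v w * \<phi> k w) - \<phi> k z * (\<Sum>w\<in>V. K v w * \<phi> l w)"
      by (simp add: x_def right_diff_distrib sum_subtractf sum_distrib_left mult_ac)
    then show ?thesis
      using v k l by (simp add: eigen_eq x_def algebra_simps)
  qed
  then have "eigenfunction V K t x"
    by (simp add: eigenfunction_def)
  moreover have "x z = 0"
    by (simp add: x_def)
  ultimately have "\<forall>v\<in>V. x v = 0"
    by (rule determined)
  then have "(\<Sum>v\<in>V. x v * \<phi> k v) = 0"
    by simp
  moreover have "(\<Sum>v\<in>V. x v * \<phi> k v)
      = \<phi> l z * (\<Sum>v\<in>V. \<phi> k v * \<phi> k v) - \<phi> k z * (\<Sum>v\<in>V. \<phi> l v * \<phi> k v)"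
    by (simp add: x_def left_diff_distrib sum_subtractf sum_distrib_left mult.assoc)
  ultimately have "\<phi> l z = 0"
    using k(1) l(1) \<open>k \<noteq> l\<close> by (simp add: orthonormal)
  then have "\<forall>v\<in>V. \<phi> l v = 0"
    using determined eigen[OF l(1)] l(2) by blast
  then show False
    using exists_nonzero[OF l(1)] by blast
qed

text \<open>Reversing signs exchanges the upper and lower ends of the spectrum, so that one half of
  interlacing implies the other.\<close>

lemma neg: "eigenbasis V (\<lambda>v w. - K v w) (\<lambda>k. - e k) \<phi>"
  using eigen
  by unfold_locales (auto simp: eigenfunction_def finite_V sym orthonormal complete sum_negf)

end

text \<open>Cauchy interlacing with its equality case: a dimension count yields a nonzero vector on which the
  quadratic form is at least \<open>t\<close> (in \<open>W\<close>) and at most \<open>t\<close> (in \<open>V\<close>) times the squared norm.\<close>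

lemma interlacing_equality:
  assumes V: "eigenbasis V K e \<phi>" and W: "eigenbasis W K f \<psi>" and sub: "W \<subseteq> V"
    and less: "card {k. k < card V \<and> e k > t} < card {k. k < card W \<and> f k \<ge> t}"
  shows "\<exists>x. (\<forall>v. v \<notin> W \<longrightarrow> x v = 0) \<and> (\<exists>v\<in>W. x v \<noteq> 0) \<and> eigenfunction V K t x"
proof -
  interpret V: eigenbasis V K e \<phi> by (rule V)
  interpret W: eigenbasis W K f \<psi> by (rule W)
  define J where "J = {k. k < card W \<and> f k \<ge> t}"
  have J: "finite J" "\<And>k. k \<in> J \<Longrightarrow> k < card W"
    by (auto simp: J_def)
  \<comment> \<open>The unknowns are the coordinates of \<open>x\<close> along those
    \<open>\<psi> k\<close> with \<open>f k \<ge> t\<close>; the equations make \<open>x\<close>,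
    extended by 0, orthogonal to every \<open>\<phi> l\<close> with \<open>e l > t\<close>.\<close>
  from underdetermined_homogeneous_system[OF _ _ less, of "\<lambda>l k. \<Sum>v\<in>W. \<psi> k v * \<phi> l v"]
  obtain c where c: "\<exists>k\<in>J. c k \<noteq> 0"
    and c0: "\<And>l. l < card V \<Longrightarrow> e l > t \<Longrightarrow> (\<Sum>k\<in>J. (\<Sum>v\<in>W. \<psi> k v * \<phi> l v) * c k) = 0"
    unfolding J_def by auto
  define x where "x v = (if v \<in> W then \<Sum>k\<in>J. c k * \<psi> k v else 0)" for v
  have restrict: "(\<Sum>v\<in>V. x v * g v) = (\<Sum>v\<in>W. x v * g v)" for g
    by (rule sum.mono_neutral_right) (use sub V.finite_V in \<open>auto simp: x_def\<close>)
  have expand: "(\<Sum>v\<in>W. x v * g v) = (\<Sum>k\<in>J. (\<Sum>v\<in>W. \<psi> k v * g v) * c k)" for g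
  proof -
    have "(\<Sum>v\<in>W. x v * g v) = (\<Sum>v\<in>W. \<Sum>k\<in>J. \<psi> k v * g v * c k)"
      by (intro sum.cong refl) (simp add: x_def sum_distrib_left sum_distrib_right mult_ac)
    then show ?thesis
      by (subst (asm) sum.swap) (simp add: sum_distrib_right)
  qed
  have V_coef: "V.coef x l = 0" if "l < card V" "e l > t" for l
    using c0[OF that] by (simp add: V.coef_def restrict expand)
  have W_coef: "W.coef x k = (if k \<in> J then c k else 0)" if k: "k < card W" for k
  proof -
    have "W.coef x k = (\<Sum>l\<in>J. if l = k then c k else 0)"
      unfolding W.coef_def expand
      by (intro sum.cong refl) (use J(2) k in \<open>auto simp: W.orthonormal\<close>)
    then show ?thesis using J(1) by simp
  qed
  have "\<exists>v\<in>W. x v \<noteq> 0"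
  proof (rule ccontr)
    assume "\<not> ?thesis"
    then have "W.coef x k = 0" for k
      by (simp add: W.coef_def)
    then show False using c J(2) W_coef by fastforce
  qed
  moreover have "(\<Sum>w\<in>V. K v w * x w) = t * x v" if v: "v \<in> V" for v
  proof -
    have norm: "(\<Sum>l<card V. V.coef x l * V.coef x l) = (\<Sum>k<card W. W.coef x k * W.coef x k)"
      unfolding V.parseval[symmetric] W.parseval[symmetric] by (rule restrict)
    have "(\<Sum>w\<in>V. K v w * x w) = (\<Sum>w\<in>W. K v w * x w)" for v
      using restrict[of "K v"] by (simp add: mult.commute)
    then have form: "(\<Sum>l<card V. e l * (V.coef x l * V.coef x l))
        = (\<Sum>k<card W. f k * (W.coef x k * W.coef x k))"
      unfolding V.quadratic_form[symmetric] W.quadratic_form[symmetric] by (simp add: restrict)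
    have "t * (\<Sum>k<card W. W.coef x k * W.coef x k) \<le> (\<Sum>k<card W. f k * (W.coef x k * W.coef x k))"
      unfolding sum_distrib_left
      by (intro sum_mono) (use W_coef in \<open>auto simp: J_def intro!: mult_right_mono\<close>)
    \<comment> \<open>The form is at least \<open>t\<close> times the squared norm by the expansion
      over \<open>W\<close>, so this sum is at most 0. Each summand is nonnegative by the expansion
      over \<open>V\<close>, so all vanish and only components with \<open>e l = t\<close>
      survive.\<close>
    then have le: "(\<Sum>l<card V. (t - e l) * (V.coef x l * V.coef x l)) \<le> 0"
      unfolding left_diff_distrib sum_subtractf sum_distrib_left[symmetric] form norm by simp
    have nonneg: "(t - e l) * (V.coef x l * V.coef x l) \<ge> 0" if "l < card V" for l
      using V_coef[OF that] by (cases "e l > t") auto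
    then have "(\<Sum>l<card V. (t - e l) * (V.coef x l * V.coef x l)) = 0"
      by (intro antisym[OF le] sum_nonneg) auto
    then have "\<forall>l<card V. (t - e l) * (V.coef x l * V.coef x l) = 0"
      using nonneg by (subst (asm) sum_nonneg_eq_0_iff) auto
    then have eq: "e l * V.coef x l = t * V.coef x l" if "l < card V" for l
      using that by auto
    have "(\<Sum>w\<in>V. K v w * x w) = (\<Sum>k<card V. e k * V.coef x k * \<phi> k v)"
      by (subst V.expansion[OF v]) (simp add: V.coef_apply)
    also have "\<dots> = t * (\<Sum>k<card V. V.coef x k * \<phi> k v)"
      by (simp add: eq sum_distrib_left mult.assoc)
    also have "\<dots> = t * x v"
      using V.expansion[OF v, of x] by simp
    finally show ?thesis .
  qed
  ultimately show ?thesis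
    by (intro exI[of _ x]) (auto simp: x_def eigenfunction_def)
qed

text \<open>If a count failed, the equality case would supply a forbidden eigenfunction. The second
  inequality is the first for \<open>-K\<close> and \<open>-t\<close>.\<close>

lemma strict_interlacing:
  assumes V: "eigenbasis V K e \<phi>" and W: "eigenbasis W K f \<psi>" and sub: "W \<subseteq> V"
    and no_eigenfunction: "\<forall>x. eigenfunction V K t x \<longrightarrow> (\<forall>v. v \<notin> W \<longrightarrow> x v = 0) \<longrightarrow> (\<forall>v\<in>W. x v = 0)"
  shows "card {k. k < card W \<and> f k \<ge> t} \<le> card {k. k < card V \<and> e k > t}"
    and "card {k. k < card W \<and> f k \<le> t} \<le> card {k. k < card V \<and> e k < t}"
proof -
  show "card {k. k < card W \<and> f k \<ge> t} \<le> card {k. k < card V \<and> e k > t}"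
  proof (rule ccontr)
    assume "\<not> ?thesis"
    then show False
      using interlacing_equality[OF V W sub, of t] no_eigenfunction by (meson not_le)
  qed
  show "card {k. k < card W \<and> f k \<le> t} \<le> card {k. k < card V \<and> e k < t}"
  proof (rule ccontr)
    assume "\<not> ?thesis"
    then have less: "card {k. k < card V \<and> - e k > - t} < card {k. k < card W \<and> - f k \<ge> - t}"
      by simp
    obtain x where x: "\<forall>v. v \<notin> W \<longrightarrow> x v = 0" "\<exists>v\<in>W. x v \<noteq> 0"
        "eigenfunction V (\<lambda>v w. - K v w) (- t) x"
      using interlacing_equality[OF eigenbasis.neg[OF V] eigenbasis.neg[OF W] sub less] by blast
    from x(3) have "eigenfunction V K t x"
      by (simp add: eigenfunction_def sum_negf)
    then show False
      using x(1,2) no_eigenfunction by blast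
  qed
qed

section \<open>Eigenbases from characteristic polynomials and adjacency matrices\<close>

text \<open>The columns of the orthogonal diagonalizing matrix form the basis; its two orthogonality
  relations give \<open>orthonormal\<close> and \<open>complete\<close>.\<close>

lemma eigenbasis_exists:
  fixes K :: "'a \<Rightarrow> 'a \<Rightarrow> real"
  assumes xs: "distinct xs" and sym: "\<And>v w. v \<in> set xs \<Longrightarrow> w \<in> set xs \<Longrightarrow> K v w = K w v"
  defines "p \<equiv> char_poly (mat (length xs) (length xs) (\<lambda>(i, j). K (xs ! i) (xs ! j)))"
  defines "es \<equiv> rev (sorted_list_of_multiset (proots p))"
  shows "p \<noteq> 0" and "length es = length xs" and "\<exists>\<phi>. eigenbasis (set xs) K (\<lambda>k. es ! k) \<phi>"
proof -
  define n where "n = length xs"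
  define A where "A = mat n n (\<lambda>(i, j). K (xs ! i) (xs ! j))"
  have A: "A \<in> carrier_mat n n"
    by (simp add: A_def)
  have p: "p = char_poly A"
    by (simp add: p_def A_def n_def)
  show "p \<noteq> 0"
    using degree_monic_char_poly[OF A] by (auto simp: p)
  have "transpose_mat A = A"
    by (rule eq_matI) (auto simp: A_def n_def sym)
  then obtain P D where PD: "similar_mat_wit A D P (transpose_mat P)" "diagonal_mat D"
    using symmetric_real_mat_diagonalizable[OF A] by blast
  note P = similar_mat_witD2[OF A PD(1)]
  have PPt: "(\<Sum>k<n. P $$ (i, k) * P $$ (j, k)) = (if i = j then 1 else 0)" if "i < n" "j < n" for i j
    using arg_cong[OF P(1), of "\<lambda>M. M $$ (i, j)"] P(6) that
    by (simp add: scalar_prod_def lessThan_atLeast0)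
  have PtP: "(\<Sum>i<n. P $$ (i, k) * P $$ (i, l)) = (if k = l then 1 else 0)" if "k < n" "l < n" for k l
    using arg_cong[OF P(2), of "\<lambda>M. M $$ (k, l)"] P(6) that
    by (simp add: scalar_prod_def lessThan_atLeast0)
  have "A * P = P * D * (transpose_mat P * P)"
    using P(4-7) by (subst P(3)) (simp add: assoc_mult_mat[of _ n n _ n _ n])
  then have AP: "A * P = P * D"
    using P(2,5,6) by simp
  have eig: "(\<Sum>j<n. A $$ (i, j) * P $$ (j, k)) = D $$ (k, k) * P $$ (i, k)" if ik: "i < n" "k < n" for i k
  proof -
    have "(\<Sum>j<n. A $$ (i, j) * P $$ (j, k)) = (\<Sum>l<n. P $$ (i, l) * D $$ (l, k))"
      using arg_cong[OF AP, of "\<lambda>M. M $$ (i, k)"] P(5,6) A ik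
      by (simp add: scalar_prod_def lessThan_atLeast0)
    also have "\<dots> = (\<Sum>l<n. if l = k then D $$ (k, k) * P $$ (i, k) else 0)"
      by (intro sum.cong refl) (use PD(2) P(5) ik in \<open>auto simp: diagonal_mat_def\<close>)
    finally show ?thesis using ik by simp
  qed
  have "char_poly A = char_poly D"
    using PD(1) by (intro char_poly_similar) (auto simp: similar_mat_def)
  moreover have "upper_triangular D"
    using PD(2) P(5) by (auto simp: diagonal_mat_def upper_triangular_def)
  ultimately have "p = (\<Prod>a\<leftarrow>diag_mat D. [:- a, 1:])"
    using char_poly_upper_triangular[OF P(5)] by (simp add: p)
  moreover have "proots (\<Prod>a\<leftarrow>as. [:- a, 1:]) = mset as" for as :: "real list"
  proof (induction as)
    case (Cons a as)
    have "(\<Prod>a\<leftarrow>as. [:- a, 1:]) \<noteq> 0"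
      by (auto simp: prod_list_zero_iff)
    then show ?case
      using Cons by (simp add: proots_mult del: mult_pCons_left)
  qed simp
  ultimately have "mset es = mset (diag_mat D)"
    by (simp add: es_def)
  moreover have len: "length (diag_mat D) = n"
    using P(5) by (simp add: diag_mat_def)
  \<comment> \<open>The diagonal of \<open>D\<close> comes in no particular order;
    \<open>\<pi>\<close> rearranges the columns so that they match the non-increasing list
    \<open>es\<close>.\<close>
  ultimately obtain \<pi> where \<pi>: "\<pi> permutes {..<n}" and es: "permute_list \<pi> (diag_mat D) = es"
    by (metis mset_eq_permutation)
  have \<pi>n: "\<pi> k < n \<longleftrightarrow> k < n" for k
    using permutes_in_image[OF \<pi>, of k] by simp
  have nth_es: "es ! k = D $$ (\<pi> k, \<pi> k)" if "k < n" for k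
    using that \<pi>n[of k] \<pi> P(5) len es[symmetric] by (simp add: permute_list_nth diag_mat_def)
  show "length es = length xs"
    using es len by (auto simp: n_def)
  define idx where "idx = inv_into {..<n} ((!) xs)"
  have bij: "bij_betw ((!) xs) {..<n} (set xs)"
    using xs by (intro bij_betw_nth) (auto simp: n_def)
  have idx_nth: "idx (xs ! i) = i" if "i < n" for i
    using that bij by (auto simp: idx_def bij_betw_def intro!: inv_into_f_f)
  have sum_xs: "(\<Sum>v\<in>set xs. g v) = (\<Sum>i<n. g (xs ! i))" for g :: "'a \<Rightarrow> real"
    by (rule sum.reindex_bij_betw[OF bij, symmetric])
  have card: "card (set xs) = n"
    using xs by (simp add: n_def distinct_card)
  have in_xs: "\<exists>i<n. v = xs ! i" if "v \<in> set xs" for v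
    using that by (metis in_set_conv_nth n_def)
  have \<pi>eq: "\<pi> k = \<pi> l \<longleftrightarrow> k = l" for k l
    using permutes_inj[OF \<pi>] by (auto simp: inj_def)
  have "eigenbasis (set xs) K (\<lambda>k. es ! k) (\<lambda>k v. P $$ (idx v, \<pi> k))"
  proof
    fix k assume k: "k < card (set xs)"
    have "(\<Sum>w\<in>set xs. K v w * P $$ (idx w, \<pi> k)) = es ! k * P $$ (idx v, \<pi> k)" if "v \<in> set xs" for v
    proof -
      obtain i where i: "i < n" "v = xs ! i"
        using in_xs \<open>v \<in> set xs\<close> by auto
      show ?thesis
        using eig[of i "\<pi> k"] i k card \<pi>n by (simp add: sum_xs idx_nth nth_es A_def)
    qed
    then show "eigenfunction (set xs) K (es ! k) (\<lambda>v. P $$ (idx v, \<pi> k))"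
      by (simp add: eigenfunction_def)
  next
    fix k l assume "k < card (set xs)" "l < card (set xs)"
    then show "(\<Sum>v\<in>set xs. P $$ (idx v, \<pi> k) * P $$ (idx v, \<pi> l)) = (if k = l then 1 else 0)"
      using PtP \<pi>n by (simp add: card sum_xs idx_nth \<pi>eq)
  next
    fix v w assume "v \<in> set xs" "w \<in> set xs"
    then obtain i j where ij: "i < n" "v = xs ! i" "j < n" "w = xs ! j"
      using in_xs by meson
    have "(\<Sum>k<n. P $$ (i, \<pi> k) * P $$ (j, \<pi> k)) = (\<Sum>k<n. P $$ (i, k) * P $$ (j, k))"
      by (rule sum.permute[OF \<pi>, symmetric, unfolded comp_def])
    then show "(\<Sum>k<card (set xs). P $$ (idx v, \<pi> k) * P $$ (idx w, \<pi> k)) = (if v = w then 1 else 0)"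
      using PPt ij xs by (simp add: card idx_nth nth_eq_iff_index_eq n_def)
  qed (auto simp: sym)
  then show "\<exists>\<phi>. eigenbasis (set xs) K (\<lambda>k. es ! k) \<phi>"
    by blast
qed

text \<open>The injection \<open>f\<close> permits a relabelling of the vertices. It places the
  spectrum of G' on a subset of the vertices of G, with the same kernel.\<close>

lemma graph_eigenbasis:
  fixes f :: "'a \<Rightarrow> 'c" and K :: "'c \<Rightarrow> 'c \<Rightarrow> real"
  assumes fin: "finite (verts G)" and inj: "inj_on f (verts G)"
    and arcs: "\<And>v w. v \<in> verts G \<Longrightarrow> w \<in> verts G \<Longrightarrow>
      K (f v) (f w) = (if (v, w) \<in> arcs_ends G then 1 else 0)"
    and sym: "\<And>v w. v \<in> f ` verts G \<Longrightarrow> w \<in> f ` verts G \<Longrightarrow> K v w = K w v"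
  shows "graph_char_poly G \<noteq> 0" and "length (graph_eigenvalues G) = card (verts G)"
    and "\<exists>\<phi>. eigenbasis (f ` verts G) K (\<lambda>k. graph_eigenvalues G ! k) \<phi>"
proof -
  obtain xs where xs: "distinct xs" "set xs = verts G"
    using fin finite_distinct_list by blast
  define ys where "ys = map f xs"
  have ys: "distinct ys" "set ys = f ` verts G"
    using xs inj by (auto simp: ys_def distinct_map)
  have "adjacency_matrix G xs = mat (length ys) (length ys) (\<lambda>(i, j). K (ys ! i) (ys ! j))"
    by (rule eq_matI) (auto simp: adjacency_matrix_def ys_def arcs xs(2)[symmetric])
  then have p: "graph_char_poly G = char_poly (mat (length ys) (length ys) (\<lambda>(i, j). K (ys ! i) (ys ! j)))"
    using graph_char_poly_eq[OF xs] by simp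
  note ex = eigenbasis_exists[of ys K, folded p, folded graph_eigenvalues_def, OF ys(1), unfolded ys(2), OF sym]
  show "graph_char_poly G \<noteq> 0" and "\<exists>\<phi>. eigenbasis (f ` verts G) K (\<lambda>k. graph_eigenvalues G ! k) \<phi>"
    using ex(1,3) by blast+
  have "length (graph_eigenvalues G) = length ys"
    using ex(2) by blast
  then show "length (graph_eigenvalues G) = card (verts G)"
    using xs distinct_card[OF xs(1)] by (simp add: ys_def)
qed

lemma graph_eigenvalues_antimono:
  "k \<le> l \<Longrightarrow> l < length (graph_eigenvalues G) \<Longrightarrow> graph_eigenvalues G ! l \<le> graph_eigenvalues G ! k"
  by (rule sorted_rev_nth_mono) (auto simp: graph_eigenvalues_def)

text \<open>By symmetry of \<open>K\<close>, if \<open>x\<close> does not vanish at \<open>u\<close>, then the eigenfunction \<open>y\<close> of \<open>V - {u}\<close>,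
  extended by \<open>0\<close>, also satisfies the equation at \<open>u\<close>.\<close>

lemma eigenfunction_vanishing_at:
  assumes fin: "finite V" and u: "u \<in> V"
    and sym: "\<And>v w. v \<in> V \<Longrightarrow> w \<in> V \<Longrightarrow> K v w = K w v"
    and x: "eigenfunction V K t x" "\<exists>v\<in>V. x v \<noteq> 0"
    and y: "eigenfunction (V - {u}) K t y" "\<exists>v\<in>V - {u}. y v \<noteq> 0"
  shows "\<exists>z. eigenfunction V K t z \<and> (\<exists>v\<in>V. z v \<noteq> 0) \<and> z u = 0"
proof (cases "x u = 0")
  case True
  then show ?thesis using x by blast
next
  case False
  define z where "z = y(u := 0)"
  \<comment> \<open>The defect of the equation at \<open>u\<close>. Pairing with \<open>x\<close>
    and moving \<open>K\<close> across by symmetry yields \<open>c * x u = 0\<close>.\<close>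
  define c where "c = (\<Sum>w\<in>V. K u w * z w)"
  have sum_z: "(\<Sum>w\<in>V. K v w * z w) = (\<Sum>w\<in>V - {u}. K v w * y w)" for v
    using fin u by (subst sum.remove[of V u]) (auto simp: z_def intro!: sum.cong)
  have row: "(\<Sum>w\<in>V. K v w * z w) = t * z v + (if v = u then c else 0)" if "v \<in> V" for v
  proof (cases "v = u")
    case True
    then show ?thesis by (simp add: c_def z_def)
  next
    case False
    then show ?thesis
      using y(1) that unfolding sum_z by (simp add: eigenfunction_def z_def)
  qed
  have "t * (\<Sum>v\<in>V. z v * x v) = (\<Sum>v\<in>V. z v * (\<Sum>w\<in>V. K v w * x w))"
    using x(1) by (simp add: eigenfunction_def sum_distrib_left mult_ac)
  also have "\<dots> = (\<Sum>w\<in>V. \<Sum>v\<in>V. z v * (K v w * x w))"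
    unfolding sum_distrib_left by (rule sum.swap)
  also have "\<dots> = (\<Sum>w\<in>V. x w * (\<Sum>v\<in>V. K w v * z v))"
    unfolding sum_distrib_left by (intro sum.cong refl) (simp add: sym)
  also have "\<dots> = (\<Sum>w\<in>V. t * (z w * x w) + (if w = u then c * x u else 0))"
  proof (intro sum.cong refl)
    fix w assume "w \<in> V"
    from row[OF this] show "x w * (\<Sum>v\<in>V. K w v * z v) = t * (z w * x w) + (if w = u then c * x u else 0)"
      by (simp add: algebra_simps)
  qed
  also have "\<dots> = t * (\<Sum>v\<in>V. z v * x v) + c * x u"
    using fin u by (simp add: sum.distrib sum_distrib_left)
  finally have "c = 0"
    using False by simp
  then have "eigenfunction V K t z"
    using row by (simp add: eigenfunction_def)
  moreover have "\<exists>v\<in>V. z v \<noteq> 0" "z u = 0"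
    using y(2) by (auto simp: z_def)
  ultimately show ?thesis by blast
qed

section \<open>Eigenfunctions of nested split graphs\<close>

text \<open>One kernel on all labels, independent of the cell sizes, so that G, G - u and G' differ
  only in the vertex set over which it is summed.\<close>

definition nsg_kernel :: "nsg_vertex \<Rightarrow> nsg_vertex \<Rightarrow> real" where
  "nsg_kernel v w = (if nsg_adj v w then 1 else 0)"

lemma nsg_kernel_sym: "nsg_kernel v w = nsg_kernel w v"
  using nsg_adj_sym by (auto simp: nsg_kernel_def)

text \<open>\<open>G\<close> lives on the cells with \<open>r = 0\<close>; \<open>G'\<close>, with its numbering shifted by \<open>s\<close>, on those with
  \<open>r = s\<close>.\<close>

definition nsg_cells :: "nat \<Rightarrow> nat \<Rightarrow> (nat \<Rightarrow> nat) \<Rightarrow> (nat \<Rightarrow> nat) \<Rightarrow> nsg_vertex set" where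
  "nsg_cells r h m n = (\<Union>i\<in>{r<..h}. nsg_U m i) \<union> (\<Union>i\<in>{r<..h}. nsg_V n i)"

lemma finite_nsg_cells: "finite (nsg_cells r h m n)"
  by (auto simp: nsg_cells_def nsg_U_def nsg_V_def)

lemma nsg_cells_iff [simp]:
  "NU i k \<in> nsg_cells r h m n \<longleftrightarrow> r < i \<and> i \<le> h \<and> k < m i"
  "NV i k \<in> nsg_cells r h m n \<longleftrightarrow> r < i \<and> i \<le> h \<and> k < n i"
  by (auto simp: nsg_cells_def nsg_U_def nsg_V_def)

lemma sum_nsg_cells:
  fixes g :: "nsg_vertex \<Rightarrow> real"
  shows "(\<Sum>w\<in>nsg_cells r h m n. g w)
    = (\<Sum>i\<in>{r<..h}. \<Sum>k<m i. g (NU i k)) + (\<Sum>i\<in>{r<..h}. \<Sum>k<n i. g (NV i k))"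
proof -
  have "(\<Sum>w\<in>nsg_cells r h m n. g w)
      = (\<Sum>w\<in>(\<Union>i\<in>{r<..h}. nsg_U m i). g w) + (\<Sum>w\<in>(\<Union>i\<in>{r<..h}. nsg_V n i). g w)"
    unfolding nsg_cells_def by (rule sum.union_disjoint) (auto simp: nsg_U_def nsg_V_def)
  also have "(\<Sum>w\<in>(\<Union>i\<in>{r<..h}. nsg_U m i). g w) = (\<Sum>i\<in>{r<..h}. \<Sum>w\<in>nsg_U m i. g w)"
    by (rule sum.UNION_disjoint) (auto simp: nsg_U_def)
  also have "(\<Sum>w\<in>(\<Union>i\<in>{r<..h}. nsg_V n i). g w) = (\<Sum>i\<in>{r<..h}. \<Sum>w\<in>nsg_V n i. g w)"
    by (rule sum.UNION_disjoint) (auto simp: nsg_V_def)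
  finally show ?thesis
    by (simp add: nsg_U_def nsg_V_def sum.reindex inj_on_def)
qed

text \<open>The eigenvalue equations involve \<open>x\<close> only through these cell totals and the
  value at the vertex itself.\<close>

definition sum_U :: "(nat \<Rightarrow> nat) \<Rightarrow> (nsg_vertex \<Rightarrow> real) \<Rightarrow> nat \<Rightarrow> real" where
  "sum_U m x i = (\<Sum>k<m i. x (NU i k))"

definition sum_V :: "(nat \<Rightarrow> nat) \<Rightarrow> (nsg_vertex \<Rightarrow> real) \<Rightarrow> nat \<Rightarrow> real" where
  "sum_V n x i = (\<Sum>k<n i. x (NV i k))"

lemma nsg_kernel_row_U:
  assumes "i \<le> h"
  shows "(\<Sum>w\<in>nsg_cells r h m n. nsg_kernel (NU i k) w * x w) = (\<Sum>j\<in>{r<..i}. sum_V n x j)"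
proof -
  have "(\<Sum>w\<in>nsg_cells r h m n. nsg_kernel (NU i k) w * x w)
      = (\<Sum>j\<in>{r<..h}. if j \<le> i then sum_V n x j else 0)"
    unfolding sum_nsg_cells by (auto simp: nsg_kernel_def sum_V_def intro!: sum.cong)
  also have "\<dots> = (\<Sum>j\<in>{r<..i}. sum_V n x j)"
    by (rule sum.mono_neutral_cong_right) (use assms in auto)
  finally show ?thesis .
qed

lemma nsg_kernel_row_V:
  assumes "r < j" "j \<le> h" "l < n j"
  shows "(\<Sum>w\<in>nsg_cells r h m n. nsg_kernel (NV j l) w * x w)
    = (\<Sum>i\<in>{r<..h}. sum_V n x i) + (\<Sum>i\<in>{j..h}. sum_U m x i) - x (NV j l)"
proof -
  have "(\<Sum>i\<in>{r<..h}. \<Sum>k<m i. nsg_kernel (NV j l) (NU i k) * x (NU i k))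
      = (\<Sum>i\<in>{r<..h}. if j \<le> i then sum_U m x i else 0)"
    by (intro sum.cong refl) (simp add: nsg_kernel_def sum_U_def)
  also have "\<dots> = (\<Sum>i\<in>{j..h}. sum_U m x i)"
    by (rule sum.mono_neutral_cong_right) (use assms in auto)
  finally have U: "(\<Sum>i\<in>{r<..h}. \<Sum>k<m i. nsg_kernel (NV j l) (NU i k) * x (NU i k))
      = (\<Sum>i\<in>{j..h}. sum_U m x i)" .
  have "(\<Sum>k<n i. nsg_kernel (NV j l) (NV i k) * x (NV i k))
      = sum_V n x i - (if i = j then x (NV j l) else 0)" for i
  proof -
    have "(\<Sum>k<n i. nsg_kernel (NV j l) (NV i k) * x (NV i k))
        = (\<Sum>k<n i. x (NV i k) - (if k = l then if i = j then x (NV j l) else 0 else 0))"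
      by (intro sum.cong refl) (auto simp: nsg_kernel_def)
    then show ?thesis
      using assms(3) by (auto simp: sum_subtractf sum_V_def)
  qed
  then have "(\<Sum>i\<in>{r<..h}. \<Sum>k<n i. nsg_kernel (NV j l) (NV i k) * x (NV i k))
      = (\<Sum>i\<in>{r<..h}. sum_V n x i) - x (NV j l)"
    using assms by (simp add: sum_subtractf)
  with U show ?thesis
    unfolding sum_nsg_cells by simp
qed

text \<open>A clique vertex is not its own neighbour; moving the missing term to the right-hand side
  produces the factor \<open>t + 1\<close>.\<close>

lemma nsg_eigenfunction_iff:
  "eigenfunction (nsg_cells r h m n) nsg_kernel t x \<longleftrightarrow>
    (\<forall>i\<in>{r<..h}. \<forall>k<m i. (\<Sum>j\<in>{r<..i}. sum_V n x j) = t * x (NU i k)) \<and>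
    (\<forall>j\<in>{r<..h}. \<forall>l<n j.
      (\<Sum>i\<in>{r<..h}. sum_V n x i) + (\<Sum>i\<in>{j..h}. sum_U m x i) = (t + 1) * x (NV j l))"
    (is "_ \<longleftrightarrow> ?U \<and> ?V")
proof -
  have all: "(\<forall>v\<in>nsg_cells r h m n. P v) \<longleftrightarrow>
      (\<forall>i\<in>{r<..h}. \<forall>k<m i. P (NU i k)) \<and> (\<forall>j\<in>{r<..h}. \<forall>l<n j. P (NV j l))" for P
    unfolding nsg_cells_def nsg_U_def nsg_V_def ball_Un ball_UN by auto
  show ?thesis
    unfolding eigenfunction_def all
    by (auto simp: nsg_kernel_row_U nsg_kernel_row_V diff_eq_eq distrib_right)
qed

lemma nsg_cells_zeroI:
  assumes "\<And>i k. r < i \<Longrightarrow> i \<le> h \<Longrightarrow> k < m i \<Longrightarrow> x (NU i k) = 0"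
    and "\<And>i k. r < i \<Longrightarrow> i \<le> h \<Longrightarrow> k < n i \<Longrightarrow> x (NV i k) = 0"
    and "v \<in> nsg_cells r h m n"
  shows "x v = 0"
  using assms by (cases v) auto

text \<open>Since \<open>t\<close> and \<open>t + 1\<close> are nonzero, each value of
  \<open>x\<close> can be recovered from cell totals and vanishes when the left-hand side of its
  equation does.\<close>

locale nsg_eigenfunction =
  fixes r h :: nat and m n :: "nat \<Rightarrow> nat" and t :: real and x :: "nsg_vertex \<Rightarrow> real"
  assumes eigenfunction: "eigenfunction (nsg_cells r h m n) nsg_kernel t x"
    and nonzero: "t \<noteq> 0" "t \<noteq> -1"
begin

lemma row_U: "r < i \<Longrightarrow> i \<le> h \<Longrightarrow> k < m i \<Longrightarrow> (\<Sum>j\<in>{r<..i}. sum_V n x j) = t * x (NU i k)"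
  using eigenfunction by (simp add: nsg_eigenfunction_iff)

lemma row_V: "r < j \<Longrightarrow> j \<le> h \<Longrightarrow> l < n j \<Longrightarrow>
    (\<Sum>i\<in>{r<..h}. sum_V n x i) + (\<Sum>i\<in>{j..h}. sum_U m x i) = (t + 1) * x (NV j l)"
  using eigenfunction by (simp add: nsg_eigenfunction_iff)

lemma U_zero: "r < i \<Longrightarrow> i \<le> h \<Longrightarrow> (\<Sum>j\<in>{r<..i}. sum_V n x j) = 0 \<Longrightarrow> k < m i \<Longrightarrow> x (NU i k) = 0"
  using row_U[of i k] nonzero by simp

lemma V_zero:
  assumes "r < j" "j \<le> h" "(\<Sum>i\<in>{r<..h}. sum_V n x i) + (\<Sum>i\<in>{j..h}. sum_U m x i) = 0" "l < n j"
  shows "x (NV j l) = 0"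
proof -
  have "t + 1 \<noteq> 0"
    using nonzero by linarith
  then show ?thesis
    using row_V[of j l] assms by simp
qed

text \<open>The equation at \<open>NU h 0\<close> makes the total over all V cells zero. Descending
  from \<open>h\<close>: if all cells above \<open>i\<close> vanish, the partial V total up to
  \<open>i\<close> is also zero, which kills cell U of index \<open>i\<close>; then nothing is left
  in the equation of cell V of index \<open>i\<close>. This is what makes \<open>t\<close>
  simple.\<close>

lemma zero_if_top_zero:
  assumes top: "r < h" "m h > 0" "x (NU h 0) = 0" and v: "v \<in> nsg_cells r h m n"
  shows "x v = 0"
proof -
  have total: "(\<Sum>j\<in>{r<..h}. sum_V n x j) = 0"
    using row_U[of h 0] top by simp
  have "(\<forall>k<m i. x (NU i k) = 0) \<and> (\<forall>k<n i. x (NV i k) = 0)" if "r < i" "i \<le> h" for i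
    using that
  proof (induction "h - i" arbitrary: i rule: less_induct)
    case less
    have above: "sum_U m x j = 0" "sum_V n x j = 0" if "i < j" "j \<le> h" for j
      using less.hyps[of j] less.prems that by (auto simp: sum_U_def sum_V_def)
    have "(\<Sum>j\<in>{r<..i}. sum_V n x j) = (\<Sum>j\<in>{r<..h}. sum_V n x j)"
      by (rule sum.mono_neutral_left) (use less.prems above in auto)
    then have U: "\<forall>k<m i. x (NU i k) = 0"
      using U_zero[of i] less.prems total by simp
    then have "sum_U m x i = 0"
      by (simp add: sum_U_def)
    then have "(\<Sum>j\<in>{i..h}. sum_U m x j) = 0"
      using above by (intro sum.neutral) (metis atLeastAtMost_iff le_neq_implies_less)
    then show ?case
      using U V_zero[of i] less.prems total by simp
  qed
  then show ?thesis
    using v by (intro nsg_cells_zeroI[of r h m x n v]) auto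
qed

text \<open>This excludes the equality case of interlacing. The equation at \<open>NV s 0\<close>
  says that the V total plus the U totals from \<open>s\<close> on is zero. Ascending: if all cells
  below \<open>i\<close> vanish, the equation of cell V of index \<open>i\<close> has this same
  left-hand side, so that cell vanishes; then the V total up to \<open>i\<close> is zero and cell U
  vanishes too.\<close>

lemma zero_if_supported_above:
  assumes s: "r < s" "s \<le> h" "n s > 0"
    and supp: "\<And>v. v \<notin> nsg_cells s h m n \<Longrightarrow> x v = 0"
    and v: "v \<in> nsg_cells r h m n"
  shows "x v = 0"
proof -
  define S where "S = (\<Sum>i\<in>{r<..h}. sum_V n x i)"
  have below: "sum_U m x i = 0" "sum_V n x i = 0" if "i \<le> s" for i
    using supp that by (auto simp: sum_U_def sum_V_def)
  \<comment> \<open>\<open>NV s 0\<close> lies outside the support, as \<open>nsg_cells s\<close>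
    starts only at cell \<open>s + 1\<close>.\<close>
  have Ss: "S + (\<Sum>i\<in>{s..h}. sum_U m x i) = 0"
    using row_V[of s 0] s supp[of "NV s 0"] by (simp add: S_def)
  have "(\<forall>k<m i. x (NU i k) = 0) \<and> (\<forall>k<n i. x (NV i k) = 0)" if "i \<le> h" for i
    using that
  proof (induction i rule: less_induct)
    case (less i)
    show ?case
    proof (cases "i \<le> s")
      case True
      then show ?thesis using supp by simp
    next
      case False
      have IH: "sum_U m x j = 0" "sum_V n x j = 0" if "j < i" for j
        using less.IH[of j] less.prems that by (auto simp: sum_U_def sum_V_def)
      have "(\<Sum>j\<in>{i..h}. sum_U m x j) = (\<Sum>j\<in>{s..h}. sum_U m x j)"
        by (rule sum.mono_neutral_left) (use False IH in auto)
      then have V: "\<forall>k<n i. x (NV i k) = 0"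
        using V_zero[of i] False s less.prems Ss by (simp add: S_def)
      then have "sum_V n x i = 0"
        by (simp add: sum_V_def)
      then have "(\<Sum>j\<in>{r<..i}. sum_V n x j) = 0"
        using IH by (intro sum.neutral) (metis greaterThanAtMost_iff le_neq_implies_less)
      then show ?thesis
        using V U_zero[of i] False s less.prems by simp
    qed
  qed
  then show ?thesis
    using v by (intro nsg_cells_zeroI[of r h m x n v]) auto
qed

text \<open>Vertices in cells beyond \<open>s\<close> see the lower cells only through their V
  total, which is zero by the equation at \<open>NU s 0\<close>.\<close>

lemma eigenfunction_above:
  assumes s: "r < s" "s \<le> h" "m s > 0" "x (NU s 0) = 0"
  shows "eigenfunction (nsg_cells s h m n) nsg_kernel t x"
proof -
  have zero: "(\<Sum>j\<in>{r<..s}. sum_V n x j) = 0"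
    using row_U[of s 0] s by simp
  have split: "(\<Sum>j\<in>{r<..i}. sum_V n x j) = (\<Sum>j\<in>{s<..i}. sum_V n x j)" if "s \<le> i" for i
  proof -
    have "{r<..i} = {r<..s} \<union> {s<..i}"
      using s that by auto
    then show ?thesis
      using zero by (simp add: sum.union_disjoint)
  qed
  show ?thesis
    unfolding nsg_eigenfunction_iff
  proof (intro conjI ballI allI impI)
    fix i k assume "i \<in> {s<..h}" "k < m i"
    then show "(\<Sum>j\<in>{s<..i}. sum_V n x j) = t * x (NU i k)"
      using row_U[of i k] split[of i] s by simp
  next
    fix j l assume "j \<in> {s<..h}" "l < n j"
    then show "(\<Sum>i\<in>{s<..h}. sum_V n x i) + (\<Sum>i\<in>{j..h}. sum_U m x i) = (t + 1) * x (NV j l)"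
      using row_V[of j l] split[of h] s by simp
  qed
qed

end

section \<open>Eigenbases of G, of G - u and of G' for the common kernel\<close>

lemma arcs_ends_nsg: "arcs_ends (nsg h m n) =
    {(v, w). v \<in> nsg_verts h m n \<and> w \<in> nsg_verts h m n \<and> nsg_adj v w}"
  by (auto simp: nsg_def arcs_ends_def arc_to_ends_def image_iff)

lemma verts_nsg: "verts (nsg h m n) = nsg_cells 0 h m n"
proof -
  have "{1..h} = {0<..h}" by auto
  then show ?thesis
    by (simp add: nsg_def nsg_verts_def nsg_cells_def)
qed

lemma nsg_eigenbasis:
  "length (graph_eigenvalues (nsg h m n)) = card (verts (nsg h m n))"
  "\<exists>\<phi>. eigenbasis (nsg_cells 0 h m n) nsg_kernel (\<lambda>k. graph_eigenvalues (nsg h m n) ! k) \<phi>"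
proof -
  have "nsg_verts h m n = verts (nsg h m n)"
    by (simp add: nsg_def)
  then show
    "length (graph_eigenvalues (nsg h m n)) = card (verts (nsg h m n))"
    "\<exists>\<phi>. eigenbasis (nsg_cells 0 h m n) nsg_kernel (\<lambda>k. graph_eigenvalues (nsg h m n) ! k) \<phi>"
    using graph_eigenbasis[of "nsg h m n" id nsg_kernel]
    by (simp_all add: verts_nsg finite_nsg_cells arcs_ends_nsg nsg_kernel_def[symmetric] nsg_kernel_sym)
qed

lemma nsg_del_vert_eigenbasis:
  fixes h m n u
  defines "G' \<equiv> pre_digraph.del_vert (nsg h m n) u"
  shows "graph_char_poly G' \<noteq> 0" and "length (graph_eigenvalues G') = card (nsg_cells 0 h m n - {u})"
    and "\<exists>\<phi>. eigenbasis (nsg_cells 0 h m n - {u}) nsg_kernel (\<lambda>k. graph_eigenvalues G' ! k) \<phi>"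
proof -
  have verts: "verts G' = nsg_cells 0 h m n - {u}"
    by (simp add: G'_def pre_digraph.verts_del_vert verts_nsg)
  have arcs: "(v, w) \<in> arcs_ends G' \<longleftrightarrow> nsg_adj v w" if "v \<in> verts G'" "w \<in> verts G'" for v w
    using that
    by (auto simp: G'_def nsg_def arcs_ends_def pre_digraph.del_vert_simps pre_digraph.ends_del_vert
      arc_to_ends_def image_iff)
  show "graph_char_poly G' \<noteq> 0" and "length (graph_eigenvalues G') = card (nsg_cells 0 h m n - {u})"
    and "\<exists>\<phi>. eigenbasis (nsg_cells 0 h m n - {u}) nsg_kernel (\<lambda>k. graph_eigenvalues G' ! k) \<phi>"
    using graph_eigenbasis[of G' id nsg_kernel]
    by (simp_all add: verts[symmetric] arcs nsg_kernel_def[symmetric] nsg_kernel_sym)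
      (simp_all add: verts finite_nsg_cells)
qed

fun nsg_shift :: "nat \<Rightarrow> nsg_vertex \<Rightarrow> nsg_vertex" where
  "nsg_shift s (NU i k) = NU (s + i) k"
| "nsg_shift s (NV i k) = NV (s + i) k"

lemma inj_nsg_shift: "inj (nsg_shift s)"
proof (rule injI)
  fix v w assume "nsg_shift s v = nsg_shift s w"
  then show "v = w" by (cases v; cases w) auto
qed

lemma nsg_adj_shift [simp]: "nsg_adj (nsg_shift s v) (nsg_shift s w) = nsg_adj v w"
  by (cases v; cases w) auto

lemma nsg_shift_image:
  assumes "s \<le> h"
  shows "nsg_shift s ` nsg_cells 0 (h - s) (\<lambda>k. m (s + k)) (\<lambda>k. n (s + k)) = nsg_cells s h m n"
proof (intro equalityI subsetI)
  fix v assume "v \<in> nsg_shift s ` nsg_cells 0 (h - s) (\<lambda>k. m (s + k)) (\<lambda>k. n (s + k))"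
  then obtain w where w: "v = nsg_shift s w" "w \<in> nsg_cells 0 (h - s) (\<lambda>k. m (s + k)) (\<lambda>k. n (s + k))"
    by blast
  then show "v \<in> nsg_cells s h m n"
    using assms by (cases w) auto
next
  fix v assume v: "v \<in> nsg_cells s h m n"
  define w where "w = (case v of NU i k \<Rightarrow> NU (i - s) k | NV i k \<Rightarrow> NV (i - s) k)"
  have "v = nsg_shift s w" "w \<in> nsg_cells 0 (h - s) (\<lambda>k. m (s + k)) (\<lambda>k. n (s + k))"
    using v assms by (cases v; auto simp: w_def)+
  then show "v \<in> nsg_shift s ` nsg_cells 0 (h - s) (\<lambda>k. m (s + k)) (\<lambda>k. n (s + k))"
    by blast
qed

text \<open>Adjacency only compares cell indices and is unaffected by the shift, so G' becomes the
  subgraph of G induced on the cells beyond \<open>s\<close>.\<close>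

lemma nsg_shift_eigenbasis:
  fixes h m n s
  assumes s: "s \<le> h"
  defines "G' \<equiv> nsg (h - s) (\<lambda>k. m (s + k)) (\<lambda>k. n (s + k))"
  shows "card (nsg_cells s h m n) = card (verts G')"
    and "\<exists>\<phi>. eigenbasis (nsg_cells s h m n) nsg_kernel (\<lambda>k. graph_eigenvalues G' ! k) \<phi>"
proof -
  have verts: "nsg_shift s ` verts G' = nsg_cells s h m n"
    using nsg_shift_image[OF s] by (simp add: G'_def verts_nsg)
  then show "card (nsg_cells s h m n) = card (verts G')"
    using card_image[OF inj_on_subset[OF inj_nsg_shift subset_UNIV]] by metis
  have arcs: "(v, w) \<in> arcs_ends G' \<longleftrightarrow> nsg_adj v w" if "v \<in> verts G'" "w \<in> verts G'" for v w
    using that by (simp add: G'_def arcs_ends_nsg) (simp add: nsg_def)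
  have "finite (verts G')"
    by (simp add: G'_def verts_nsg finite_nsg_cells)
  then show "\<exists>\<phi>. eigenbasis (nsg_cells s h m n) nsg_kernel (\<lambda>k. graph_eigenvalues G' ! k) \<phi>"
    using graph_eigenbasis(3)[of G' "nsg_shift s" nsg_kernel, unfolded verts] inj_nsg_shift[of s]
    by (simp add: arcs nsg_kernel_def inj_on_subset nsg_kernel_sym[unfolded nsg_kernel_def])
qed


section \<open>Neutral vertices and the position of the eigenvalue in both spectra\<close>

text \<open>For a simple eigenvalue the level sets are index intervals, which translates the counts
  of interlacing into inequalities between positions.\<close>

lemma antimono_level_sets:
  fixes g :: "nat \<Rightarrow> real"
  assumes anti: "\<And>k l. k \<le> l \<Longrightarrow> l < N \<Longrightarrow> g l \<le> g k"
    and p: "p < N" "g p = t" and unique: "\<And>k. k < N \<Longrightarrow> g k = t \<Longrightarrow> k = p"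
  shows "{k. k < N \<and> g k > t} = {..<p}" "{k. k < N \<and> g k \<ge> t} = {..p}"
    "{k. k < N \<and> g k < t} = {p<..<N}" "{k. k < N \<and> g k \<le> t} = {p..<N}"
proof -
  have gt: "g k > t \<longleftrightarrow> k < p" if "k < N" for k
  proof
    assume "g k > t"
    then show "k < p"
      using anti[of p k] p that by (meson not_le)
  next
    assume "k < p"
    then show "g k > t"
      using anti[of k p] unique[of k] p that by (metis nless_le order_le_less)
  qed
  have eq: "g k = t \<longleftrightarrow> k = p" if "k < N" for k
    using unique[OF that] p(2) by blast
  have lt: "g k < t \<longleftrightarrow> p < k" if "k < N" for k
    using gt[OF that] eq[OF that] by (metis linorder_neqE_nat linorder_neqE_linordered_idom
      order_less_asym order_less_irrefl)
  show "{k. k < N \<and> g k > t} = {..<p}" "{k. k < N \<and> g k \<ge> t} = {..p}"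
    "{k. k < N \<and> g k < t} = {p<..<N}" "{k. k < N \<and> g k \<le> t} = {p..<N}"
    using gt lt p(1) by (auto simp: not_less[symmetric])
qed

text \<open>Neutrality keeps \<open>t\<close> in the spectrum of G - u, and an eigenvector there
  combines with \<open>x\<close> to one of G vanishing at \<open>u\<close>.\<close>

lemma neutral_eigenfunction:
  fixes h m n
  defines "C \<equiv> nsg_cells 0 h m n"
  assumes neutral: "neutral_vertex (nsg h m n) t u"
    and x: "eigenfunction C nsg_kernel t x" "\<exists>v\<in>C. x v \<noteq> 0"
  shows "\<exists>z. eigenfunction C nsg_kernel t z \<and> (\<exists>v\<in>C. z v \<noteq> 0) \<and> z u = 0"
proof -
  define H where "H = pre_digraph.del_vert (nsg h m n) u"
  note H = nsg_del_vert_eigenbasis[of h m n u, folded H_def C_def]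
  from H(3) obtain \<psi> where "eigenbasis (C - {u}) nsg_kernel (\<lambda>k. graph_eigenvalues H ! k) \<psi>"
    by blast
  then interpret H: eigenbasis "C - {u}" nsg_kernel "\<lambda>k. graph_eigenvalues H ! k" \<psi> .
  have "Polynomial.order t (graph_char_poly H) \<ge> 1"
    using neutral by (simp add: neutral_vertex_def eigenvalue_multiplicity_def H_def)
  then have "t \<in># proots (graph_char_poly H)"
    using H(1) by (simp add: order_root)
  then have "t \<in> set (graph_eigenvalues H)"
    by (simp add: graph_eigenvalues_def)
  then obtain k where k: "k < card (C - {u})" "graph_eigenvalues H ! k = t"
    using H(2) by (metis in_set_conv_nth)
  have "eigenfunction (C - {u}) nsg_kernel t (\<psi> k)"
    using H.eigen[OF k(1)] k(2) by simp
  moreover have "u \<in> C"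
    using neutral by (simp add: neutral_vertex_def verts_nsg C_def)
  ultimately show ?thesis
    using eigenfunction_vanishing_at[of C u nsg_kernel t x "\<psi> k"] x H.exists_nonzero[OF k(1)]
    by (simp add: C_def finite_nsg_cells nsg_kernel_sym)
qed

theorem theorem2p8:
  fixes h s i N N' :: nat
    and m n :: "nat \<Rightarrow> nat"
    and G G' :: "(nsg_vertex, nsg_vertex \<times> nsg_vertex) pre_digraph"
  assumes "h \<ge> 3"
    and "\<forall>k\<in>{1..h}. m k > 0 \<and> n k > 0"
    and "G = nsg h m n"
    and "N = card (verts G)"
    and "2 \<le> s" and "s \<le> h - 1"
    and "i \<in> {1..N}"
    and "nth_eigenvalue G i \<noteq> 0" and "nth_eigenvalue G i \<noteq> -1"
    and "\<forall>u\<in>nsg_U m s. neutral_vertex G (nth_eigenvalue G i) u"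
    and "G' = nsg (h - s) (\<lambda>k. m (s + k)) (\<lambda>k. n (s + k))"
    and "N' = card (verts G')"
  shows "(\<exists>j\<in>{1..N'}. nth_eigenvalue G i = nth_eigenvalue G' j \<and> j < i \<and> i < N - N' + j) \<and>
    (i \<le> N' \<longrightarrow> nth_eigenvalue G i \<noteq> nth_eigenvalue G' N')"
proof -
  define t where "t = nth_eigenvalue G i"
  define C where "C r = nsg_cells r h m n" for r
  \<comment> \<open>Eigenvalues are numbered from 1 but list positions from 0; likewise
    \<open>j\<close> will be \<open>Suc q\<close>.\<close>
  define p where "p = i - 1"
  have t0: "t \<noteq> 0" "t \<noteq> -1"
    using assms(8,9) by (auto simp: t_def)
  have sh: "0 < s" "s < h" "s \<le> h" "0 < h"
    using assms(1,5,6) by auto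
  have pos: "m s > 0" "n s > 0" "m h > 0"
    using assms(2) sh by auto
  have p: "p < N" "graph_eigenvalues G ! p = t"
    using assms(7) by (auto simp: p_def t_def nth_eigenvalue_def)
  have N: "card (C 0) = N" "length (graph_eigenvalues G) = N"
    using nsg_eigenbasis(1)[of h m n] assms(3,4) by (simp_all add: verts_nsg C_def)
  have N': "card (C s) = N'" "length (graph_eigenvalues G') = N'"
    using nsg_shift_eigenbasis(1)[OF sh(3), of m n] nsg_eigenbasis(1) assms(11,12)
    by (simp_all add: C_def)
  obtain \<phi> where \<phi>: "eigenbasis (C 0) nsg_kernel (\<lambda>k. graph_eigenvalues G ! k) \<phi>"
    using nsg_eigenbasis(2)[of h m n] assms(3) by (auto simp: C_def)
  obtain \<psi> where \<psi>: "eigenbasis (C s) nsg_kernel (\<lambda>k. graph_eigenvalues G' ! k) \<psi>"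
    using nsg_shift_eigenbasis(2)[OF sh(3), of m n] assms(11) by (auto simp: C_def)
  interpret G: eigenbasis "C 0" nsg_kernel "\<lambda>k. graph_eigenvalues G ! k" \<phi> by (rule \<phi>)
  interpret G': eigenbasis "C s" nsg_kernel "\<lambda>k. graph_eigenvalues G' ! k" \<psi> by (rule \<psi>)
  have efI: "nsg_eigenfunction r h m n t x"
    if "eigenfunction (C r) nsg_kernel t x" for r x
    using that t0 by unfold_locales (auto simp: C_def)
  have top: "NU h 0 \<in> C r" if "r < h" for r
    using that pos by (simp add: C_def)
  have determined: "\<forall>v\<in>C r. x v = 0"
    if "r < h" "eigenfunction (C r) nsg_kernel t x" "x (NU h 0) = 0" for r x
    using nsg_eigenfunction.zero_if_top_zero[OF efI[OF that(2)] that(1) pos(3) that(3)]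
    by (simp add: C_def)
  have unique: "k = p" if "k < N" "graph_eigenvalues G ! k = t" for k
    using G.eigenvalue_unique[OF top[OF sh(4)] determined[OF sh(4)]] that p N by blast
  have "eigenfunction (C 0) nsg_kernel t (\<phi> p)"
    using G.eigen[of p] p N by simp
  moreover have "neutral_vertex (nsg h m n) t (NU s 0)"
    using assms(3,10) pos by (auto simp: t_def nsg_U_def)
  ultimately obtain z where z: "eigenfunction (C 0) nsg_kernel t z" "\<exists>v\<in>C 0. z v \<noteq> 0" "z (NU s 0) = 0"
    using neutral_eigenfunction[of h m n t "NU s 0" "\<phi> p"] G.exists_nonzero[of p] p N
    by (auto simp: C_def)
  have "eigenfunction (C s) nsg_kernel t z"
    using nsg_eigenfunction.eigenfunction_above[OF efI[OF z(1)] sh(1,3) pos(1) z(3)] by (simp add: C_def)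
  \<comment> \<open>The top cell belongs to G' as well, so the restriction of \<open>z\<close> to G'
    is not zero.\<close>
  moreover have "z (NU h 0) \<noteq> 0"
    using determined[OF sh(4) z(1)] z(2) by blast
  ultimately obtain q where q: "q < N'" "graph_eigenvalues G' ! q = t"
    using G'.eigenvalue_is_listed[of t z "NU h 0"] top[OF sh(2)] N' by auto
  have unique': "k = q" if "k < N'" "graph_eigenvalues G' ! k = t" for k
    using G'.eigenvalue_unique[OF top[OF sh(2)] determined[OF sh(2)]] that q N' by blast
  have sub: "C s \<subseteq> C 0"
    by (auto simp: C_def nsg_cells_def)
  have no_eigenfunction: "\<forall>x. eigenfunction (C 0) nsg_kernel t x \<longrightarrow> (\<forall>v. v \<notin> C s \<longrightarrow> x v = 0) \<longrightarrow>
      (\<forall>v\<in>C s. x v = 0)"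
    using nsg_eigenfunction.zero_if_supported_above[OF efI sh(1,3) pos(2)] sub by (auto simp: C_def)
  note interlacing = strict_interlacing[OF \<phi> \<psi> sub no_eigenfunction, unfolded N N']
  have anti: "graph_eigenvalues G ! l \<le> graph_eigenvalues G ! k" if "k \<le> l" "l < N" for k l
    by (rule graph_eigenvalues_antimono) (simp_all add: that N)
  have anti': "graph_eigenvalues G' ! l \<le> graph_eigenvalues G' ! k" if "k \<le> l" "l < N'" for k l
    by (rule graph_eigenvalues_antimono) (simp_all add: that N')
  note level = antimono_level_sets[of N "(!) (graph_eigenvalues G)", OF anti p unique]
  note level' = antimono_level_sets[of N' "(!) (graph_eigenvalues G')", OF anti' q unique']
  \<comment> \<open>The first count compares eigenvalues from \<open>t\<close> upwards in G' with
    those above \<open>t\<close> in G; the second does the same downwards.\<close>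
  have "card {..q} \<le> card {..<p}" "card {q..<N'} \<le> card {p<..<N}"
    using interlacing by (simp_all only: level level')
  then have bounds: "q < p" "N' - q \<le> N - Suc p"
    by auto
  \<comment> \<open>Ensures that \<open>N - N'\<close> is a genuine difference of natural
    numbers.\<close>
  have "N' \<le> N"
    using card_mono[OF G.finite_V sub] N N' by simp
  then have "Suc q < i" "i < N - N' + Suc q"
    using bounds q(1) p(1) assms(7) by (auto simp: p_def)
  moreover have "t = nth_eigenvalue G' (Suc q)"
    using q by (simp add: nth_eigenvalue_def)
  \<comment> \<open>If \<open>t\<close> were also the last eigenvalue of G', uniqueness would give
    \<open>q = N' - 1\<close>, whereas \<open>q < p = i - 1 \<le> N' - 1\<close>.\<close>
  moreover have "t \<noteq> nth_eigenvalue G' N'" if "i \<le> N'"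
    using unique'[of "N' - 1"] q(1) bounds(1) that by (auto simp: nth_eigenvalue_def p_def)
  ultimately show ?thesis
    using q(1) unfolding t_def[symmetric] by (intro conjI bexI[of _ "Suc q"]) auto
qed

end
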